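(* Vertex covers can be learned by equivalence queries in $O(n^2)$ rounds: there is a learning algorithm that makes only (non-extended) equivalence queries, with hypotheses that are graphs on $\{1,\dots,n\}$, and that, for every graph $G$ on $\{1,\dots,n\}$ and every competent Teacher, produces a hypothesis graph $H$ that is equivalent to $G$ with respect to the vertex cover concept after $O(n^2)$ queries.
   Context: A vertex set concept is a predicate $\Phi(G,V')$ on finite graphs $G$ and sets $V'\subseteq V(G)$; its solution set is $S(G)=\{V'\subseteq V(G):\Phi(G,V')\}$. Graphs $G,H$ are $\Phi$-equivalent if $V(G)=V(H)$ and $S(G)=S(H)$. Here $\Phi(G,V')$ means "$V'$ is a vertex cover of $G$", i.e. every edge of $G$ has at least one endpoint in $V'$. Learning model (exact learning by equivalence queries): a Teacher privately holds a graph $G$ with vertex set $V=\{1,\dots,n\}$, and the Learner initially knows only $n$. In an equivalence query the Learner presents a hypothesis graph $H$ on $\{1,\dots,n\}$. If $H$ is $\Phi$-equivalent to $G$, the Teacher answers "finished". Otherwise the Teacher returns a counterexample: either a positive counterexample, i.e. a set $V'$ with $\Phi(G,V')$ true and $\Phi(H,V')$ false, or a negative counterexample, i.e. a set $V'$ with $\Phi(H,V')$ true and $\Phi(G,V')$ false. A Teacher is competent if it always answers queries correctly; it may choose any valid counterexample. A learning algorithm for $\Phi$ is a Learner strategy that, against every competent Teacher and every graph $G$, eventually obtains the answer "finished". It runs in $f(n)$ rounds if, for every graph of order $n$ and every competent Teacher, it finishes after at most $f(n)$ queries. *)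

theory Defs
  imports Complex_Main "HOL-Library.Landau_Symbols"
begin

record ugraph =
  verts :: "nat set"
  edges :: "nat set set"

definition simple_graph :: "ugraph \<Rightarrow> bool" where
  "simple_graph G \<longleftrightarrow>
     finite (verts G) \<and> (\<forall>e\<in>edges G. e \<subseteq> verts G \<and> card e = 2)"

definition graph_on :: "nat \<Rightarrow> ugraph \<Rightarrow> bool" where
  "graph_on n G \<longleftrightarrow> simple_graph G \<and> verts G = {1..n}"

type_synonym concept = "ugraph \<Rightarrow> nat set \<Rightarrow> bool"

definition solutions :: "concept \<Rightarrow> ugraph \<Rightarrow> nat set set" where
  "solutions \<Phi> G = {V'. V' \<subseteq> verts G \<and> \<Phi> G V'}"

definition equivalent :: "concept \<Rightarrow> ugraph \<Rightarrow> ugraph \<Rightarrow> bool" where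
  "equivalent \<Phi> G H \<longleftrightarrow> verts G = verts H \<and> solutions \<Phi> G = solutions \<Phi> H"

definition vertex_cover :: concept where
  "vertex_cover G V' \<longleftrightarrow> (\<forall>e\<in>edges G. e \<inter> V' \<noteq> {})"

datatype answer = Finished | Positive "nat set" | Negative "nat set"

definition correct_answer :: "concept \<Rightarrow> ugraph \<Rightarrow> ugraph \<Rightarrow> answer \<Rightarrow> bool" where
  "correct_answer \<Phi> G H a \<longleftrightarrow>
     (case a of
        Finished \<Rightarrow> equivalent \<Phi> H G
      | Positive V' \<Rightarrow> \<not> equivalent \<Phi> H G \<and> V' \<in> solutions \<Phi> G - solutions \<Phi> H
      | Negative V' \<Rightarrow> \<not> equivalent \<Phi> H G \<and> V' \<in> solutions \<Phi> H - solutions \<Phi> G)"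

text \<open>
  A history lists the queries asked so far, oldest first, each with its answer. A Learner maps
  the order \<open>n\<close> and the history to the next hypothesis, so it knows nothing else about
  the hidden graph. A Teacher's answer may depend on the history, so it may be adaptive and
  need not answer a repeated query in the same way.
\<close>

type_synonym history = "(ugraph \<times> answer) list"
type_synonym learner = "nat \<Rightarrow> history \<Rightarrow> ugraph"
type_synonym teacher = "history \<Rightarrow> ugraph \<Rightarrow> answer"

definition learner_strategy :: "learner \<Rightarrow> bool" where
  "learner_strategy L \<longleftrightarrow> (\<forall>n h. graph_on n (L n h))"

definition competent :: "concept \<Rightarrow> nat \<Rightarrow> ugraph \<Rightarrow> teacher \<Rightarrow> bool" where
  "competent \<Phi> n G T \<longleftrightarrow> (\<forall>h H. graph_on n H \<longrightarrow> correct_answer \<Phi> G H (T h H))"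

text \<open>
  The interaction is continued formally beyond the answer \<open>Finished\<close>; only the part up to
  the first such answer matters. Queries are numbered from \<open>0\<close>.
\<close>

primrec history_after :: "learner \<Rightarrow> teacher \<Rightarrow> nat \<Rightarrow> nat \<Rightarrow> history" where
  "history_after L T n 0 = []"
| "history_after L T n (Suc k) =
     (let h = history_after L T n k; H = L n h in h @ [(H, T h H)])"

definition hypothesis :: "learner \<Rightarrow> teacher \<Rightarrow> nat \<Rightarrow> nat \<Rightarrow> ugraph" where
  "hypothesis L T n k = L n (history_after L T n k)"

definition reply :: "learner \<Rightarrow> teacher \<Rightarrow> nat \<Rightarrow> nat \<Rightarrow> answer" where
  "reply L T n k = T (history_after L T n k) (hypothesis L T n k)"

definition learning_algorithm :: "concept \<Rightarrow> learner \<Rightarrow> bool" where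
  "learning_algorithm \<Phi> L \<longleftrightarrow> learner_strategy L \<and>
     (\<forall>n G T. graph_on n G \<longrightarrow> competent \<Phi> n G T \<longrightarrow> (\<exists>k. reply L T n k = Finished))"

definition runs_in_rounds :: "concept \<Rightarrow> learner \<Rightarrow> (nat \<Rightarrow> nat) \<Rightarrow> bool" where
  "runs_in_rounds \<Phi> L f \<longleftrightarrow>
     (\<forall>n G T. graph_on n G \<longrightarrow> competent \<Phi> n G T \<longrightarrow>
        (\<exists>k<f n. reply L T n k = Finished))"

lemma finished_imp_equivalent:
  assumes "learner_strategy L" "competent \<Phi> n G T" "reply L T n k = Finished"
  shows "equivalent \<Phi> (hypothesis L T n k) G"
proof -
  have "graph_on n (hypothesis L T n k)"
    using assms(1) by (simp add: learner_strategy_def hypothesis_def)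
  then have "correct_answer \<Phi> G (hypothesis L T n k) (reply L T n k)"
    using assms(2) by (simp add: competent_def reply_def)
  then show ?thesis
    using assms(3) by (simp add: correct_answer_def)
qed

lemma competent_teacher_exists:
  assumes "graph_on n G"
  shows "\<exists>T. competent \<Phi> n G T"
proof -
  have "\<exists>a. correct_answer \<Phi> G H a" if "graph_on n H" for H
  proof (cases "equivalent \<Phi> H G")
    case True
    then have "correct_answer \<Phi> G H Finished" by (simp add: correct_answer_def)
    then show ?thesis ..
  next
    case False
    then have "solutions \<Phi> H \<noteq> solutions \<Phi> G"
      using assms that by (simp add: equivalent_def graph_on_def)
    then obtain V' where
      "V' \<in> solutions \<Phi> G - solutions \<Phi> H \<or> V' \<in> solutions \<Phi> H - solutions \<Phi> G"
      by blast
    then have "correct_answer \<Phi> G H (Positive V') \<or> correct_answer \<Phi> G H (Negative V')"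
      using False by (auto simp: correct_answer_def)
    then show ?thesis by blast
  qed
  then have "competent \<Phi> n G (\<lambda>h H. SOME a. correct_answer \<Phi> G H a)"
    unfolding competent_def by (blast intro: someI_ex)
  then show ?thesis by blast
qed

end

(* The Learner starts from the complete graph and deletes every edge missed by some positive
   counterexample. Such an edge is not in G, so each hypothesis contains G and all its vertex
   covers are covers of G: the Teacher can only give positive counterexamples, each of which
   deletes at least one of the n choose 2 edges. *)
theory Submission
  imports Defs
begin

text \<open>The hypothesis is recomputed from the whole history rather than edited from the previous
  one, so it is a graph on \<open>{1..n}\<close> for every history, even one that no competent
  Teacher produces.\<close>

definition deletion_learner :: learner where
  "deletion_learner n h =
     \<lparr>verts = {1..n},
      edges = {e. e \<subseteq> {1..n} \<and> card e = 2 \<and> (\<forall>H V'. (H, Positive V') \<in> set h \<longrightarrow> e \<inter> V' \<noteq> {})}\<rparr>"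

lemma deletion_learner_strategy: "learner_strategy deletion_learner"
  by (auto simp: learner_strategy_def deletion_learner_def graph_on_def simple_graph_def)

lemma history_after_Suc:
  "history_after L T n (Suc k) = history_after L T n k @ [(hypothesis L T n k, reply L T n k)]"
  by (simp add: hypothesis_def reply_def Let_def)

lemma correct_reply:
  assumes "learner_strategy L" "competent \<Phi> n G T"
  shows "correct_answer \<Phi> G (hypothesis L T n k) (reply L T n k)"
  using assms by (simp add: learner_strategy_def competent_def hypothesis_def reply_def)

text \<open>All answers concern the same hidden \<open>G\<close>, so a positive counterexample from
  any earlier round is still known to be a cover of \<open>G\<close>.\<close>

lemma correct_history:
  assumes "learner_strategy L" "competent \<Phi> n G T" "(H, a) \<in> set (history_after L T n k)"
  shows "correct_answer \<Phi> G H a"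
  using assms(3)
proof (induction k)
  case (Suc k)
  then show ?case
    using correct_reply[OF assms(1,2), of k] by (auto simp: history_after_Suc simp del: history_after.simps(2))
qed simp

text \<open>Invariant of the run: every recorded positive set covers \<open>G\<close> and so meets
  each edge of \<open>G\<close>, which therefore survives all deletions.\<close>

lemma edges_subset_hypothesis:
  assumes "graph_on n G" "competent vertex_cover n G T"
  shows "edges G \<subseteq> edges (hypothesis deletion_learner T n k)"
proof
  fix e
  assume e: "e \<in> edges G"
  have "e \<inter> V' \<noteq> {}" if "(H, Positive V') \<in> set (history_after deletion_learner T n k)" for H V'
    using correct_history[OF deletion_learner_strategy assms(2) that] e
    by (auto simp: correct_answer_def solutions_def vertex_cover_def)
  then show "e \<in> edges (hypothesis deletion_learner T n k)"
    using assms(1) e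
    by (simp add: hypothesis_def deletion_learner_def graph_on_def simple_graph_def) blast
qed

lemma unfinished_reply_positive:
  assumes "graph_on n G" "competent vertex_cover n G T"
    and "reply deletion_learner T n k \<noteq> Finished"
  obtains V' where "reply deletion_learner T n k = Positive V'"
    and "\<not> vertex_cover (hypothesis deletion_learner T n k) V'"
proof -
  let ?H = "hypothesis deletion_learner T n k"
  have "verts ?H = verts G"
    using assms(1) by (simp add: hypothesis_def deletion_learner_def graph_on_def)
  \<comment> \<open>Having more edges leaves fewer covers; this rules out negative
    counterexamples.\<close>
  moreover from this have "solutions vertex_cover ?H \<subseteq> solutions vertex_cover G"
    using edges_subset_hypothesis[OF assms(1,2), of k]
    by (auto simp: solutions_def vertex_cover_def)
  moreover have "correct_answer vertex_cover G ?H (reply deletion_learner T n k)"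
    using deletion_learner_strategy assms(2) by (rule correct_reply)
  \<comment> \<open>As \<open>V'\<close> lies in the common vertex set, it can fail to be a solution
    of \<open>?H\<close> only by missing an edge.\<close>
  ultimately show thesis
    using assms(3) that
    by (cases "reply deletion_learner T n k") (auto simp: correct_answer_def solutions_def)
qed

lemma finite_hypothesis_edges: "finite (edges (hypothesis deletion_learner T n k))"
  by (rule finite_subset[of _ "Pow {1..n}"]) (auto simp: hypothesis_def deletion_learner_def)

text \<open>Potential argument: each unfinished round costs at least one edge, so remaining edges
  plus rounds never exceed the edge count of the complete graph.\<close>

lemma card_edges_hypothesis:
  assumes "graph_on n G" "competent vertex_cover n G T"
    and "\<And>j. j < k \<Longrightarrow> reply deletion_learner T n j \<noteq> Finished"
  shows "card (edges (hypothesis deletion_learner T n k)) + k \<le> n choose 2"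
  using assms(3)
proof (induction k)
  case 0
  show ?case
    using n_subsets[of "{1..n}" 2] by (simp add: hypothesis_def deletion_learner_def)
next
  case (Suc k)
  let ?E = "\<lambda>k. edges (hypothesis deletion_learner T n k)"
  obtain V' where V': "reply deletion_learner T n k = Positive V'"
    and "\<not> vertex_cover (hypothesis deletion_learner T n k) V'"
    using unfinished_reply_positive[OF assms(1,2)] Suc.prems by blast
  then obtain e where e: "e \<in> ?E k" "e \<inter> V' = {}"
    by (auto simp: vertex_cover_def)
  \<comment> \<open>The history gains one entry, with answer \<open>Positive V'\<close>, which adds
    exactly one condition on the surviving edges.\<close>
  have *: "?E (Suc k) = {e \<in> ?E k. e \<inter> V' \<noteq> {}}"
    using V' unfolding hypothesis_def[of _ _ _ "Suc k"] history_after_Suc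
    by (auto simp: hypothesis_def deletion_learner_def)
  have "?E (Suc k) \<subset> ?E k"
    unfolding * using e by blast
  then have "card (?E (Suc k)) < card (?E k)"
    using finite_hypothesis_edges by (rule psubset_card_mono[rotated])
  with Suc show ?case by force
qed

text \<open>If the queries numbered 0 to \<open>n choose 2\<close> all stayed unfinished, the
  potential bound would give \<open>Suc (n choose 2) \<le> n choose 2\<close>.\<close>

lemma deletion_learner_finishes:
  assumes "graph_on n G" "competent vertex_cover n G T"
  shows "\<exists>k<Suc (n choose 2). reply deletion_learner T n k = Finished"
  using card_edges_hypothesis[OF assms, of "Suc (n choose 2)"] by fastforce

theorem theorem2p1:
  shows "\<exists>(L :: learner) (f :: nat \<Rightarrow> nat).
           learning_algorithm vertex_cover L \<and>
           runs_in_rounds vertex_cover L f \<and>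
           (\<lambda>n. real (f n)) \<in> O(\<lambda>n. real n ^ 2) \<and>
           (\<forall>n G T. graph_on n G \<longrightarrow> competent vertex_cover n G T \<longrightarrow>
              (\<exists>k<f n. reply L T n k = Finished \<and>
                        equivalent vertex_cover (hypothesis L T n k) G))"
proof (intro exI[of _ deletion_learner] exI[of _ "\<lambda>n. Suc (n choose 2)"] conjI allI impI)
  show "learning_algorithm vertex_cover deletion_learner"
    using deletion_learner_strategy deletion_learner_finishes
    by (fastforce simp: learning_algorithm_def)
  show "runs_in_rounds vertex_cover deletion_learner (\<lambda>n. Suc (n choose 2))"
    using deletion_learner_finishes by (simp add: runs_in_rounds_def)
  show "(\<lambda>n. real (Suc (n choose 2))) \<in> O(\<lambda>n. real n ^ 2)"
  \<comment> \<open>The constant 2 pays for \<open>n choose 2\<close> and for the one extra round,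
    each at most \<open>n ^ 2\<close>. The estimate fails at \<open>n = 0\<close>, where it would
    read \<open>1 \<le> 0\<close>.\<close>
  proof (rule bigoI[of _ 2], rule eventually_sequentiallyI[of 1])
    fix n :: nat
    assume "1 \<le> n"
    moreover from this have "1 \<le> n ^ 2" by simp
    moreover have "n choose 2 \<le> n ^ 2"
      by (cases "2 \<le> n") (auto intro: binomial_le_pow simp: binomial_eq_0)
    ultimately have "Suc (n choose 2) \<le> 2 * n ^ 2" by linarith
    then have "real (Suc (n choose 2)) \<le> real (2 * n ^ 2)" by (rule of_nat_mono)
    then show "norm (real (Suc (n choose 2))) \<le> 2 * norm (real n ^ 2)" by simp
  qed
  fix n G T
  assume "graph_on n G" and T: "competent vertex_cover n G T"
  then show "\<exists>k<Suc (n choose 2). reply deletion_learner T n k = Finished \<and>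
      equivalent vertex_cover (hypothesis deletion_learner T n k) G"
    using deletion_learner_finishes finished_imp_equivalent[OF deletion_learner_strategy T] by blast
qed

end
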